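(* Every coarsely amenable metric space has strong Property A.
   Context: Let $X$ be a metric space with metric $d$; $B(x,r)=\{y : d(x,y)<r\}$. A cover of $X$ is an indexed family $\mathcal{U}=\{U_s\}_{s\in S}$ of subsets with union $X$ (counted with multiplicity). It is uniformly bounded if there is $r<\infty$ such that $d(x,y)<r$ whenever $x,y$ lie in the same element; the diameter of a set is the infimum of $r$ such that $d(x,y)<r$ for all $x,y$ in the set. The Lebesgue number of a cover is the supremum of all $r\ge0$ such that every ball $B(x,r)$ is contained in some element of the cover. For $A\subset X$, the horizon is $\operatorname{hor}(A,\mathcal{U})=\{s\in S: A\cap U_s\neq\emptyset\}$. $X$ is coarsely amenable if for each $s>r>0$ and each $\epsilon>0$ there is a uniformly bounded cover $\mathcal{U}$ of $X$ such that for each $x\in X$ the horizon $\operatorname{hor}(B(x,s),\mathcal{U})$ is finite and $\frac{|\operatorname{hor}(B(x,r),\mathcal{U})|}{|\operatorname{hor}(B(x,s),\mathcal{U})|}>1-\epsilon$. For a set $V$, $l_1(V)$ is the space of functions $\alpha:V\to\mathbb{R}$ with $\|\alpha\|=\sum_{v}|\alpha(v)|<\infty$; $\operatorname{st}(v)=\{\alpha\in l_1(V):\alpha(v)\ne0\}$. A barycentric partition of unity on $X$ is a function $f:X\to l_1(V)$ such that for each $x\in X$ there is a finite non-empty $C(x)\subset V$ with $f(x)=\chi_{C(x)}/|C(x)|$. It is $(\epsilon,\epsilon)$-Lipschitz if $\|f(x)-f(y)\|\le\epsilon d(x,y)+\epsilon$ for all $x,y$; it is cobounded if there is $M>0$ with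 $\operatorname{diam}(f^{-1}(\operatorname{st}(v)))<M$ for all $v\in V$; its Lebesgue number is that of the cover $\{f^{-1}(\operatorname{st}(v))\}_{v\in V}$. $X$ has strong Property A if for every $\epsilon>0$ there is an $(\epsilon,\epsilon)$-Lipschitz barycentric partition of unity on $X$ that is cobounded and whose Lebesgue number is at least $\frac1\epsilon$. *)

theory Defs
  imports "HOL-Analysis.Analysis"
begin

context Metric_space
begin

subsection \<open>Covers\<close>

text \<open>A cover is an indexed family \<open>U\<close> over an index set \<open>S\<close>, so repeated members are
  counted with multiplicity.\<close>

definition cover :: "'i set \<Rightarrow> ('i \<Rightarrow> 'a set) \<Rightarrow> bool" where
  "cover S U \<longleftrightarrow> (\<Union>s\<in>S. U s) = M"

definition uniformly_bounded :: "'i set \<Rightarrow> ('i \<Rightarrow> 'a set) \<Rightarrow> bool" where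
  "uniformly_bounded S U \<longleftrightarrow> (\<exists>r::real. \<forall>s\<in>S. \<forall>x\<in>U s. \<forall>y\<in>U s. d x y < r)"

text \<open>The diameter is \<open>\<infinity>\<close> for an unbounded set and \<open>0\<close> for the empty set (the restriction
  \<open>r \<ge> 0\<close> only matters for the latter).\<close>

definition diam :: "'a set \<Rightarrow> ereal" where
  "diam A = Inf {ereal r |r. 0 \<le> r \<and> (\<forall>x\<in>A. \<forall>y\<in>A. d x y < r)}"

definition lebesgue_number :: "'i set \<Rightarrow> ('i \<Rightarrow> 'a set) \<Rightarrow> ereal" where
  "lebesgue_number S U = Sup {ereal r |r. 0 \<le> r \<and> (\<forall>x\<in>M. \<exists>s\<in>S. mball x r \<subseteq> U s)}"

definition horizon :: "'a set \<Rightarrow> 'i set \<Rightarrow> ('i \<Rightarrow> 'a set) \<Rightarrow> 'i set" where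
  "horizon A S U = {s \<in> S. A \<inter> U s \<noteq> {}}"

text \<open>HOL cannot quantify existentially over types, so the notions below that assert the existence
  of a cover or of a vertex set take as a parameter the type from which its indices are drawn; the
  index set is an arbitrary set over that type.  The type \<open>'a \<times> nat\<close> is always large enough:
  if all horizons of points are finite, then the indices of nonempty members inject into it.\<close>

definition coarsely_amenable :: "'i itself \<Rightarrow> bool" where
  "coarsely_amenable (_ :: 'i itself) \<longleftrightarrow>
     (\<forall>r s \<epsilon> :: real. 0 < r \<and> r < s \<and> 0 < \<epsilon> \<longrightarrow>
        (\<exists>(S :: 'i set) U. cover S U \<and> uniformly_bounded S U \<and>
           (\<forall>x\<in>M. finite (horizon (mball x s) S U) \<and>
              real (card (horizon (mball x r) S U)) / real (card (horizon (mball x s) S U))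
                > 1 - \<epsilon>)))"

end


subsection \<open>The space \<open>l\<^sub>1(V)\<close>\<close>

text \<open>A function on \<open>V\<close> is represented by its extension by zero.\<close>

definition l1 :: "'v set \<Rightarrow> ('v \<Rightarrow> real) set" where
  "l1 V = {\<alpha>. (\<forall>v. v \<notin> V \<longrightarrow> \<alpha> v = 0) \<and> (\<lambda>v. \<bar>\<alpha> v\<bar>) summable_on V}"

definition l1_norm :: "'v set \<Rightarrow> ('v \<Rightarrow> real) \<Rightarrow> real" where
  "l1_norm V \<alpha> = (\<Sum>\<^sub>\<infinity>v\<in>V. \<bar>\<alpha> v\<bar>)"

definition star :: "'v set \<Rightarrow> 'v \<Rightarrow> ('v \<Rightarrow> real) set" where
  "star V v = {\<alpha> \<in> l1 V. \<alpha> v \<noteq> 0}"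


subsection \<open>Barycentric partitions of unity\<close>

context Metric_space
begin

definition barycentric_partition :: "'v set \<Rightarrow> ('a \<Rightarrow> 'v \<Rightarrow> real) \<Rightarrow> bool" where
  "barycentric_partition V f \<longleftrightarrow> f \<in> M \<rightarrow> l1 V \<and>
     (\<forall>x\<in>M. \<exists>C. C \<subseteq> V \<and> finite C \<and> C \<noteq> {} \<and> f x = (\<lambda>v. indicator C v / real (card C)))"

definition lipschitz_l1 :: "real \<Rightarrow> real \<Rightarrow> 'v set \<Rightarrow> ('a \<Rightarrow> 'v \<Rightarrow> real) \<Rightarrow> bool" where
  "lipschitz_l1 K c V f \<longleftrightarrow>
     (\<forall>x\<in>M. \<forall>y\<in>M. l1_norm V (\<lambda>v. f x v - f y v) \<le> K * d x y + c)"

definition star_preimage :: "'v set \<Rightarrow> ('a \<Rightarrow> 'v \<Rightarrow> real) \<Rightarrow> 'v \<Rightarrow> 'a set" where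
  "star_preimage V f v = {x \<in> M. f x \<in> star V v}"

definition cobounded :: "'v set \<Rightarrow> ('a \<Rightarrow> 'v \<Rightarrow> real) \<Rightarrow> bool" where
  "cobounded V f \<longleftrightarrow> (\<exists>b>0. \<forall>v\<in>V. diam (star_preimage V f v) < ereal b)"

definition strong_property_A :: "'v itself \<Rightarrow> bool" where
  "strong_property_A (_ :: 'v itself) \<longleftrightarrow>
     (\<forall>\<epsilon>::real. 0 < \<epsilon> \<longrightarrow>
        (\<exists>(V :: 'v set) f. barycentric_partition V f \<and> lipschitz_l1 \<epsilon> \<epsilon> V f \<and>
           cobounded V f \<and> lebesgue_number V (star_preimage V f) \<ge> ereal (1 / \<epsilon>)))"

end

end

theory Submission
  imports Defs
begin

text \<open>
  Given \<open>\<epsilon>\<close>, apply coarse amenability with radii \<open>1/\<epsilon> < 5/\<epsilon>\<close> and tolerance \<open>\<epsilon>/2\<close>, and send \<open>x\<close> to the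
  normalised characteristic function of \<open>C x\<close>, the horizon of the ball of radius \<open>3/\<epsilon>\<close> around \<open>x\<close>.
  If \<open>d x y < 2/\<epsilon>\<close>, then \<open>C x\<close> and \<open>C y\<close> lie between the horizons of the balls of radii \<open>1/\<epsilon>\<close>
  and \<open>5/\<epsilon>\<close> around \<open>x\<close>, so the two functions are at distance at most \<open>\<epsilon>\<close>; otherwise the trivial
  bound \<open>2 \<le> \<epsilon> * d x y\<close> suffices.
  The indices are moved to \<open>'a \<times> nat\<close> by choosing a point in each nonempty member and numbering
  the finitely many members with the same chosen point.
\<close>

section \<open>Distances between normalised indicators in \<open>l1\<close>\<close>

text \<open>Since \<open>\<bar>a - b\<bar> = a + b - 2 * min a b\<close> and both functions have
  total mass 1, it suffices to bound the common mass from below. On \<open>C\<close> each function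
  is at least \<open>1 / card D\<close>, because \<open>A\<close> and \<open>B\<close> have at most
  as many elements as \<open>D\<close>.\<close>

lemma sum_abs_diff_normalised_indicators_le:
  fixes A B C D :: "'v set"
  assumes "finite D" "A \<subseteq> D" "B \<subseteq> D" "C \<subseteq> A \<inter> B" "A \<noteq> {}" "B \<noteq> {}"
  shows "(\<Sum>v\<in>D. \<bar>indicator A v / real (card A) - indicator B v / real (card B)\<bar>)
           \<le> 2 * (1 - real (card C) / real (card D))"
proof -
  define a where "a v = (indicator A v / real (card A) :: real)" for v
  define b where "b v = (indicator B v / real (card B) :: real)" for v
  have normalised: "(\<Sum>v\<in>D. indicator E v / real (card E)) = (1::real)" if "E \<subseteq> D" "E \<noteq> {}" for E
  proof -
    have "finite E"
      using that(1) assms(1) by (rule finite_subset)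
    moreover have "(\<Sum>v\<in>D. indicator E v) = real (card E)"
      using that(1) assms(1) by (simp add: indicator_def sum.If_cases Int_absorb1)
    ultimately show ?thesis
      using that(2) by (simp flip: sum_divide_distrib)
  qed
  have "1 / real (card D) \<le> min (a v) (b v)" if "v \<in> C" for v
  proof -
    have "finite A" "finite B"
      using assms(1-3) finite_subset by auto
    then have "0 < card A" "0 < card B" "card A \<le> card D" "card B \<le> card D"
      using assms by (auto simp: card_gt_0_iff intro: card_mono)
    then show ?thesis
      using that assms(4) by (auto simp: a_def b_def frac_le)
  qed
  then have "real (card C) / real (card D) \<le> (\<Sum>v\<in>C. min (a v) (b v))"
    using sum_bounded_below[of C "1 / real (card D)" "\<lambda>v. min (a v) (b v)"] by simp
  also have "\<dots> \<le> (\<Sum>v\<in>D. min (a v) (b v))"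
    using assms by (intro sum_mono2) (auto simp: a_def b_def)
  finally have "real (card C) / real (card D) \<le> (\<Sum>v\<in>D. min (a v) (b v))" .
  moreover have "(\<Sum>v\<in>D. \<bar>a v - b v\<bar>) = (\<Sum>v\<in>D. a v + b v - 2 * min (a v) (b v))"
    by (rule sum.cong) auto
  moreover have "\<dots> = 2 - 2 * (\<Sum>v\<in>D. min (a v) (b v))"
    using normalised[of A] normalised[of B] assms
    by (simp add: sum.distrib sum_subtractf sum_distrib_left a_def b_def)
  ultimately show ?thesis
    by (simp add: a_def b_def)
qed

lemma l1_norm_eq_sum:
  assumes "finite D" "D \<subseteq> V" "\<And>v. v \<in> V - D \<Longrightarrow> \<alpha> v = 0"
  shows "l1_norm V \<alpha> = (\<Sum>v\<in>D. \<bar>\<alpha> v\<bar>)"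
proof -
  have "l1_norm V \<alpha> = (\<Sum>\<^sub>\<infinity>v\<in>D. \<bar>\<alpha> v\<bar>)"
    unfolding l1_norm_def using assms by (intro infsum_cong_neutral) auto
  then show ?thesis
    using assms(1) by simp
qed

lemma l1_norm_diff_normalised_indicators_le:
  assumes "finite D" "D \<subseteq> V" "A \<subseteq> D" "B \<subseteq> D" "C \<subseteq> A \<inter> B" "A \<noteq> {}" "B \<noteq> {}"
  shows "l1_norm V (\<lambda>v. indicator A v / real (card A) - indicator B v / real (card B))
           \<le> 2 * (1 - real (card C) / real (card D))"
proof -
  have "l1_norm V (\<lambda>v. indicator A v / real (card A) - indicator B v / real (card B))
      = (\<Sum>v\<in>D. \<bar>indicator A v / real (card A) - indicator B v / real (card B)\<bar>)"
    using assms by (intro l1_norm_eq_sum) (auto simp: indicator_def)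
  then show ?thesis
    using sum_abs_diff_normalised_indicators_le[of D A B C] assms by simp
qed

lemma finite_support_in_l1:
  assumes "finite C" "C \<subseteq> V" "\<And>v. v \<notin> C \<Longrightarrow> \<alpha> v = 0"
  shows "\<alpha> \<in> l1 V"
proof -
  have "(\<lambda>v. \<bar>\<alpha> v\<bar>) summable_on C"
    using assms(1) by simp
  then have "(\<lambda>v. \<bar>\<alpha> v\<bar>) summable_on V"
    using assms by (subst summable_on_cong_neutral[where T = C and g = "\<lambda>v. \<bar>\<alpha> v\<bar>"]) auto
  then show ?thesis
    using assms by (auto simp: l1_def)
qed

section \<open>Transfer of a cover to the index type \<open>'a \<times> nat\<close>\<close>

lemma exists_inj_on_prod_nat:
  fixes p :: "'i \<Rightarrow> 'a"
  assumes "\<And>x. finite {s \<in> T. p s = x}"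
  shows "\<exists>g :: 'i \<Rightarrow> 'a \<times> nat. inj_on g T"
proof -
  have "\<exists>k :: 'i \<Rightarrow> nat. inj_on k {s \<in> T. p s = x}" for x
    using finite_imp_inj_to_nat_seg[OF assms] by blast
  then obtain k :: "'a \<Rightarrow> 'i \<Rightarrow> nat" where "\<And>x. inj_on (k x) {s \<in> T. p s = x}"
    by metis
  then have "inj_on (\<lambda>s. (p s, k (p s) s)) T"
    by (auto simp: inj_on_def)
  then show ?thesis
    by blast
qed

context Metric_space
begin

lemma horizon_mono: "A \<subseteq> B \<Longrightarrow> horizon A S U \<subseteq> horizon B S U"
  by (auto simp: horizon_def)

lemma horizon_image:
  "horizon A (g ` T) W = g ` horizon A T (\<lambda>s. W (g s))"
  by (auto simp: horizon_def)

lemma reindex_nonempty_members: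
  fixes S :: "'i set"
  assumes cover: "cover S U"
    and bounded: "uniformly_bounded S U"
    and fin: "\<And>x. x \<in> M \<Longrightarrow> finite (horizon {x} S U)"
  obtains V :: "('a \<times> nat) set" and W where
    "cover V W" "uniformly_bounded V W"
    "\<And>A. \<exists>h. bij_betw h (horizon A S U) (horizon A V W)"
proof -
  define T where "T = {s \<in> S. U s \<noteq> {}}"
  have "\<forall>s\<in>T. \<exists>x. x \<in> U s"
    by (auto simp: T_def)
  then obtain p where p: "\<And>s. s \<in> T \<Longrightarrow> p s \<in> U s"
    by metis
  \<comment> \<open>Members with chosen point \<open>x\<close> all contain \<open>x\<close>, hence
    belong to its horizon; over points outside \<open>M\<close> the fibre is empty.\<close>
  have "finite {s \<in> T. p s = x}" for x
  proof (cases "x \<in> M")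
    case True
    have "{s \<in> T. p s = x} \<subseteq> horizon {x} S U"
      using p by (auto simp: T_def horizon_def)
    then show ?thesis
      using fin[OF True] finite_subset by blast
  next
    case False
    then have "{s \<in> T. p s = x} = {}"
      using p cover by (auto simp: T_def cover_def)
    then show ?thesis
      by (simp only: finite.emptyI)
  qed
  then obtain g :: "'i \<Rightarrow> 'a \<times> nat" where g: "inj_on g T"
    using exists_inj_on_prod_nat by blast
  \<comment> \<open>The inverse is meaningful only on the image of \<open>T\<close> under
    \<open>g\<close>, which becomes the new index set.\<close>
  define W where "W v = U (the_inv_into T g v)" for v
  have W: "W (g s) = U s" if "s \<in> T" for s
    using that g by (simp add: W_def the_inv_into_f_f)
  have "cover (g ` T) W"
    using cover W by (auto simp: cover_def T_def)
  moreover have "uniformly_bounded (g ` T) W"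
    using bounded W unfolding uniformly_bounded_def T_def by (smt (verit) image_iff mem_Collect_eq)
  moreover have "\<exists>h. bij_betw h (horizon A S U) (horizon A (g ` T) W)" for A
  proof -
    have "horizon A T (\<lambda>s. W (g s)) = horizon A T U"
      using W by (auto simp: horizon_def)
    moreover have "horizon A T U = horizon A S U"
      by (auto simp: horizon_def T_def)
    ultimately have "horizon A (g ` T) W = g ` horizon A S U"
      by (simp add: horizon_image)
    moreover have "inj_on g (horizon A S U)"
      using g by (rule inj_on_subset) (auto simp: horizon_def T_def)
    ultimately show ?thesis
      unfolding bij_betw_def by blast
  qed
  ultimately show ?thesis
    using that by blast
qed

lemma coarsely_amenable_prod_nat:
  assumes "coarsely_amenable TYPE('i)"
  shows "coarsely_amenable TYPE('a \<times> nat)"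
  unfolding coarsely_amenable_def
proof (intro allI impI)
  fix r s \<epsilon> :: real
  assume rs: "0 < r \<and> r < s \<and> 0 < \<epsilon>"
  then obtain S :: "'i set" and U where U: "cover S U" "uniformly_bounded S U"
    and hor: "\<And>x. x \<in> M \<Longrightarrow> finite (horizon (mball x s) S U) \<and>
       real (card (horizon (mball x r) S U)) / real (card (horizon (mball x s) S U)) > 1 - \<epsilon>"
    using assms unfolding coarsely_amenable_def by metis
  have "finite (horizon {x} S U)" if "x \<in> M" for x
    using hor[OF that] that rs horizon_mono[of "{x}" "mball x s" S U]
    by (auto dest: finite_subset)
  then obtain V :: "('a \<times> nat) set" and W where W: "cover V W" "uniformly_bounded V W"
    and bij: "\<And>A. \<exists>h. bij_betw h (horizon A S U) (horizon A V W)"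
    using reindex_nonempty_members[OF U] by blast
  have "card (horizon A S U) = card (horizon A V W)"
       "finite (horizon A S U) = finite (horizon A V W)" for A
    using bij[of A] bij_betw_same_card bij_betw_finite by blast+
  then show "\<exists>(S :: ('a \<times> nat) set) U. cover S U \<and> uniformly_bounded S U \<and>
      (\<forall>x\<in>M. finite (horizon (mball x s) S U) \<and>
         real (card (horizon (mball x r) S U)) / real (card (horizon (mball x s) S U)) > 1 - \<epsilon>)"
    using W hor by metis
qed

section \<open>Construction of the barycentric partition from a cover\<close>

text \<open>The indices of the cover serve as vertices. The preimage of the star of \<open>v\<close>
  is then the open \<open>3/\<epsilon>\<close>-neighbourhood of \<open>U v\<close>, which yields
  both coboundedness and the Lebesgue number.\<close>

lemma coarsely_amenable_imp_strong_property_A: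
  assumes "coarsely_amenable TYPE('v)"
  shows "strong_property_A TYPE('v)"
  unfolding strong_property_A_def
proof (intro allI impI)
  fix \<epsilon> :: real
  assume \<epsilon>: "0 < \<epsilon>"
  then have "0 < 1 / \<epsilon> \<and> 1 / \<epsilon> < 5 / \<epsilon> \<and> 0 < \<epsilon> / 2"
    by (simp add: divide_strict_right_mono)
  then obtain V :: "'v set" and U where cover: "cover V U" and "uniformly_bounded V U"
    and hor: "\<And>x. x \<in> M \<Longrightarrow> finite (horizon (mball x (5 / \<epsilon>)) V U)"
      "\<And>x. x \<in> M \<Longrightarrow> real (card (horizon (mball x (1 / \<epsilon>)) V U))
         / real (card (horizon (mball x (5 / \<epsilon>)) V U)) > 1 - \<epsilon> / 2"
    using assms unfolding coarsely_amenable_def by metis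
  then obtain b where b: "\<And>v x y. v \<in> V \<Longrightarrow> x \<in> U v \<Longrightarrow> y \<in> U v \<Longrightarrow> d x y < b"
    unfolding uniformly_bounded_def by blast
  define C where "C x = horizon (mball x (3 / \<epsilon>)) V U" for x
  define f where "f x = (\<lambda>v. indicator (C x) v / real (card (C x)))" for x
  have C_V: "C x \<subseteq> V" for x
    by (auto simp: C_def horizon_def)
  have C_finite: "finite (C x)" if "x \<in> M" for x
    unfolding C_def
    by (rule finite_subset[OF horizon_mono hor(1)[OF that]])
      (rule mball_subset_concentric, use \<epsilon> in \<open>simp add: divide_right_mono\<close>)
  have point: "\<exists>v\<in>V. x \<in> U v" if "x \<in> M" for x
    using that cover by (auto simp: cover_def)
  have C_nonempty: "C x \<noteq> {}" if "x \<in> M" for x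
    using point[OF that] that \<epsilon> by (fastforce simp: C_def horizon_def)
  have barycentric: "barycentric_partition V f"
    unfolding barycentric_partition_def
  proof
    show "f \<in> M \<rightarrow> l1 V"
      using C_finite C_V by (intro funcsetI finite_support_in_l1[OF C_finite]) (auto simp: f_def)
    show "\<forall>x\<in>M. \<exists>C. C \<subseteq> V \<and> finite C \<and> C \<noteq> {} \<and> f x = (\<lambda>v. indicator C v / real (card C))"
    proof
      fix x
      assume "x \<in> M"
      then show "\<exists>C. C \<subseteq> V \<and> finite C \<and> C \<noteq> {} \<and> f x = (\<lambda>v. indicator C v / real (card C))"
        using C_V C_finite C_nonempty by (intro exI[of _ "C x"]) (simp add: f_def)
    qed
  qed
  have preimage: "star_preimage V f v = {x \<in> M. v \<in> C x}" for v
  proof -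
    have "f x \<in> star V v \<longleftrightarrow> v \<in> C x" if "x \<in> M" for x
    proof -
      have "f x \<in> l1 V"
        using barycentric that by (auto simp: barycentric_partition_def)
      \<comment> \<open>Were the cardinality 0, division by zero would make \<open>f x\<close>
        vanish even on \<open>C x\<close>.\<close>
      moreover have "card (C x) \<noteq> 0"
        using C_finite C_nonempty that by simp
      ultimately show ?thesis
        by (simp add: star_def f_def indicator_def)
    qed
    then show ?thesis
      by (auto simp: star_preimage_def)
  qed
  have "lipschitz_l1 \<epsilon> \<epsilon> V f"
    unfolding lipschitz_l1_def
  proof (intro ballI)
    fix x y
    assume xy: "x \<in> M" "y \<in> M"
    show "l1_norm V (\<lambda>v. f x v - f y v) \<le> \<epsilon> * d x y + \<epsilon>"
    proof (cases "d x y < 2 / \<epsilon>")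
      case True
      have "C z \<subseteq> horizon (mball x (5 / \<epsilon>)) V U" and "horizon (mball x (1 / \<epsilon>)) V U \<subseteq> C z"
        if "z \<in> M" "d x z < 2 / \<epsilon>" for z
      proof -
        \<comment> \<open>The three radii are spaced by \<open>2/\<epsilon>\<close>, exactly the
          bound on \<open>d x z\<close>.\<close>
        have "d z x + 3 / \<epsilon> \<le> 5 / \<epsilon>" "d x z + 1 / \<epsilon> \<le> 3 / \<epsilon>"
          using that \<epsilon> by (auto simp: commute field_simps)
        then show "C z \<subseteq> horizon (mball x (5 / \<epsilon>)) V U" "horizon (mball x (1 / \<epsilon>)) V U \<subseteq> C z"
          unfolding C_def using that(1) xy(1) by (simp_all add: horizon_mono mball_subset)
      qed
      \<comment> \<open>The inclusions are used for \<open>z = x\<close> as well as for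
        \<open>z = y\<close>.\<close>
      moreover have "d x x < 2 / \<epsilon>"
        using xy(1) \<epsilon> by simp
      ultimately have "l1_norm V (\<lambda>v. f x v - f y v) \<le>
          2 * (1 - real (card (horizon (mball x (1 / \<epsilon>)) V U))
             / real (card (horizon (mball x (5 / \<epsilon>)) V U)))"
        unfolding f_def using xy True
        by (intro l1_norm_diff_normalised_indicators_le hor C_nonempty Int_greatest)
          (auto simp: horizon_def)
      \<comment> \<open>The tolerance \<open>\<epsilon>/2\<close> absorbs the factor 2.\<close>
      also have "\<dots> \<le> \<epsilon>"
        using hor(2)[OF xy(1)] by (simp add: algebra_simps)
      also have "\<dots> \<le> \<epsilon> * d x y + \<epsilon>"
        using \<epsilon> by simp
      finally show ?thesis .
    next
      case False
      \<comment> \<open>With the empty set as common part, the estimate reduces to the trivial bound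
        2.\<close>
      have "l1_norm V (\<lambda>v. f x v - f y v)
          \<le> 2 * (1 - real (card ({} :: 'v set)) / real (card (C x \<union> C y)))"
        unfolding f_def using xy C_V C_finite C_nonempty
        by (intro l1_norm_diff_normalised_indicators_le) auto
      also have "\<dots> \<le> \<epsilon> * d x y + \<epsilon>"
        using False \<epsilon> by (simp add: field_simps)
      finally show ?thesis .
    qed
  qed
  moreover have "cobounded V f"
    unfolding cobounded_def
  proof (intro exI conjI ballI)
    \<comment> \<open>Two steps of length below \<open>3/\<epsilon>\<close> lead into
      \<open>U v\<close> and out of it. The absolute value keeps \<open>c\<close> nonnegative, as
      \<open>diam\<close> demands, even if all members are empty and \<open>b\<close> is negative.
      The strict bound in \<open>cobounded\<close> is met by \<open>c + 1\<close>.\<close>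
    define c where "c = 3 / \<epsilon> + \<bar>b\<bar> + 3 / \<epsilon>"
    have c: "0 \<le> c"
      using \<epsilon> by (simp add: c_def)
    then show "0 < c + 1"
      by simp
    fix v
    assume v: "v \<in> V"
    have "d x y < c" if "x \<in> star_preimage V f v" "y \<in> star_preimage V f v" for x y
    proof -
      obtain x' y' where "x' \<in> U v" "y' \<in> U v"
        and M: "x \<in> M" "y \<in> M" "x' \<in> M" "y' \<in> M" and "d x x' < 3 / \<epsilon>" "d y y' < 3 / \<epsilon>"
        using \<open>x \<in> _\<close> \<open>y \<in> _\<close> unfolding preimage C_def horizon_def by auto
      moreover have "d x' y' < b"
        using b v \<open>x' \<in> U v\<close> \<open>y' \<in> U v\<close> by blast
      moreover have "d x y \<le> d x x' + d x' y' + d y y'"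
        using triangle[of x x' y] triangle[of x' y' y] M by (simp add: commute)
      ultimately show ?thesis
        by (simp add: c_def)
    qed
    then have "diam (star_preimage V f v) \<le> ereal c"
      unfolding diam_def using c by (intro Inf_lower) blast
    also have "\<dots> < ereal (c + 1)"
      by simp
    finally show "diam (star_preimage V f v) < ereal (c + 1)" .
  qed
  moreover have "lebesgue_number V (star_preimage V f) \<ge> ereal (1 / \<epsilon>)"
    unfolding lebesgue_number_def
  proof (intro Sup_upper CollectI exI conjI ballI)
    show "0 \<le> 1 / \<epsilon>"
      using \<epsilon> by simp
    fix x
    assume x: "x \<in> M"
    then obtain v where v: "v \<in> V" "x \<in> U v"
      using point by blast
    \<comment> \<open>The centre \<open>x\<close> itself witnesses that the larger ball around
      \<open>y\<close> meets \<open>U v\<close>.\<close>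
    have "v \<in> C y" if "y \<in> mball x (1 / \<epsilon>)" for y
    proof -
      have "1 / \<epsilon> < 3 / \<epsilon>"
        using \<epsilon> by (simp add: divide_strict_right_mono)
      then have "x \<in> mball y (3 / \<epsilon>)"
        using that by (auto simp: commute)
      then show ?thesis
        using v by (auto simp: C_def horizon_def)
    qed
    then have "mball x (1 / \<epsilon>) \<subseteq> star_preimage V f v"
      by (auto simp: preimage)
    then show "\<exists>v\<in>V. mball x (1 / \<epsilon>) \<subseteq> star_preimage V f v"
      using v(1) by blast
  qed simp
  ultimately show "\<exists>(V :: 'v set) f. barycentric_partition V f \<and> lipschitz_l1 \<epsilon> \<epsilon> V f \<and>
      cobounded V f \<and> lebesgue_number V (star_preimage V f) \<ge> ereal (1 / \<epsilon>)"
    using barycentric by blast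
qed

end

theorem proposition6p3:
  fixes M :: "'a set" and d :: "'a \<Rightarrow> 'a \<Rightarrow> real"
  assumes "Metric_space M d"
    and "Metric_space.coarsely_amenable M d TYPE('i)"
  shows "Metric_space.strong_property_A M d TYPE('a \<times> nat)"
proof -
  interpret Metric_space M d
    by (rule assms(1))
  show ?thesis
    using coarsely_amenable_imp_strong_property_A[OF coarsely_amenable_prod_nat[OF assms(2)]] .
qed

end
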